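(* Let $m\ge 1$, $n\ge 2m+1$, $N\ge 2$ be integers, let $c>0$, $\Delta x>0$, $\Delta t>0$, and let $u$ be a smooth solution of the linear advection equation $\frac{\partial u}{\partial t}=c\,\frac{\partial u}{\partial x}$. For grid points $x_1,\dots,x_n$ (with spacing $\Delta x$) and sampling times $t_0,\dots,t_{N-1}$ (with spacing $\Delta t$), put for each $i\in\{1,\dots,n\}$ $$\mathbf{u}_i=\big(u(x_i,t_k)\big)_{k=0}^{N-1},\quad \mathbf{u}_{x,i}=\Big(\tfrac{\partial u}{\partial x}(x_i,t_k)\Big)_{k=0}^{N-1},\quad \mathbf{u}_{t,i}=\Big(\tfrac{\partial u}{\partial t}(x_i,t_k)\Big)_{k=0}^{N-1}\in\mathbb{R}^N,$$ and assume that $\mathbf{u}_i$ and $\mathbf{u}_{x,i}$ are linearly independent for every $i$. Let $\bm{\beta}_i=(\beta_{i,j})_{j=-m}^{m}\in\mathbb{R}^{2m+1}$ be the first-order data-driven coefficient vector for the symmetric stencil $Q_i=\{i-m,\dots,i,\dots,i+m\}$ (as defined in the context), and let $\mathbf{A}_d\in\mathbb{R}^{n\times n}$ be the inferred linear operator whose $i$-th row has the entry $\beta_{i,j}$ in column $i+j$ (indices modulo $n$) for $j=-m,\dots,m$, and zeros elsewhere. If $$\frac{\Delta t}{\Delta x}\le\frac{m+1}{3c},$$ then $\|\bm{\beta}_i\|_1\le 1$ for all $i\in\{1,\dots,n\}$, and hence the inferred discrete-time system $\mathbf{u}^{k+1}=\mathbf{A}_d\mathbf{u}^k$ is stable, i.e.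 every eigenvalue $\lambda$ of $\mathbf{A}_d$ satisfies $|\lambda|\le 1$.
   Context: The first-order data-driven coefficient vector $\bm{\beta}_i$ is defined by replacing the data in the least squares problem for row $i$ by their first-order Taylor approximations, $u(x_{i+j},t_k)\approx u(x_i,t_k)+j\Delta x\,\frac{\partial u}{\partial x}(x_i,t_k)$ and $u(x_i,t_{k+1})\approx u(x_i,t_k)+\Delta t\,\frac{\partial u}{\partial t}(x_i,t_k)$, and solving in two steps: (1) Let $\mathbf{y}_i\in\mathbb{R}^2$ be the least squares solution of the overdetermined system $$\begin{bmatrix}\mathbf{u}_i & \mathbf{u}_{x,i}\end{bmatrix}\mathbf{y}_i=\mathbf{u}_i+\Delta t\,\mathbf{u}_{t,i}.$$ (2) Let $\bm{\beta}_i$ be the minimum-Euclidean-norm solution of the underdetermined system $\mathbf{M}\bm{\beta}_i=\mathbf{y}_i$, where $$\mathbf{M}=\begin{bmatrix}1&\cdots&1&\cdots&1\\ -m\Delta x&\cdots&0&\cdots&m\Delta x\end{bmatrix}\in\mathbb{R}^{2\times(2m+1)},$$ that is, $\bm{\beta}_i=\mathbf{M}^\top(\mathbf{M}\mathbf{M}^\top)^{-1}\mathbf{y}_i$. The entries of $\bm{\beta}_i$ are indexed by the stencil offset $j=-m,\dots,m$. Stability of a linear discrete-time system $\mathbf{u}^{k+1}=\mathbf{A}_d\mathbf{u}^k$ means that all eigenvalues of $\mathbf{A}_d$ lie in the closed unit disc. *)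

theory Defs
  imports "HOL-Analysis.Derivative" "Jordan_Normal_Form.Char_Poly"
begin

(* The solution u is curried: u x t is the value at position x and time t. Its domain is a
   product X * T of intervals, which need not be open: "at x within X" is the ordinary derivative
   at interior points of X and the one-sided derivative at an endpoint that belongs to X. *)

definition partial_x :: "real set \<Rightarrow> (real \<Rightarrow> real \<Rightarrow> real) \<Rightarrow> real \<Rightarrow> real \<Rightarrow> real" where
  "partial_x X u = (\<lambda>x t. vector_derivative (\<lambda>s. u s t) (at x within X))"

definition partial_t :: "real set \<Rightarrow> (real \<Rightarrow> real \<Rightarrow> real) \<Rightarrow> real \<Rightarrow> real \<Rightarrow> real" where
  "partial_t T u = (\<lambda>x t. vector_derivative (\<lambda>s. u x s) (at t within T))"

fun Ck_on :: "nat \<Rightarrow> real set \<Rightarrow> real set \<Rightarrow> (real \<Rightarrow> real \<Rightarrow> real) \<Rightarrow> bool" where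
  "Ck_on 0 X T u \<longleftrightarrow> continuous_on (X \<times> T) (\<lambda>(x, t). u x t)"
| "Ck_on (Suc k) X T u \<longleftrightarrow>
     continuous_on (X \<times> T) (\<lambda>(x, t). u x t) \<and>
     (\<forall>x\<in>X. \<forall>t\<in>T. (\<lambda>s. u s t) differentiable (at x within X) \<and>
                    (\<lambda>s. u x s) differentiable (at t within T)) \<and>
     Ck_on k X T (partial_x X u) \<and> Ck_on k X T (partial_t T u)"

definition smooth_on :: "real set \<Rightarrow> real set \<Rightarrow> (real \<Rightarrow> real \<Rightarrow> real) \<Rightarrow> bool" where
  "smooth_on X T u \<longleftrightarrow> (\<forall>k. Ck_on k X T u)"

definition smooth_advection_solution ::
    "real \<Rightarrow> real set \<Rightarrow> real set \<Rightarrow> (real \<Rightarrow> real \<Rightarrow> real) \<Rightarrow> bool" where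
  "smooth_advection_solution c X T u \<longleftrightarrow>
     smooth_on X T u \<and> (\<forall>x\<in>X. \<forall>t\<in>T. partial_t T u x t = c * partial_x X u x t)"

definition time_samples :: "nat \<Rightarrow> (nat \<Rightarrow> real) \<Rightarrow> (real \<Rightarrow> real \<Rightarrow> real) \<Rightarrow> real \<Rightarrow> real vec" where
  "time_samples N t f \<xi> = vec N (\<lambda>k. f \<xi> (t k))"

definition lin_independent_pair :: "nat \<Rightarrow> real vec \<Rightarrow> real vec \<Rightarrow> bool" where
  "lin_independent_pair N v w \<longleftrightarrow>
     (\<forall>a b. a \<cdot>\<^sub>v v + b \<cdot>\<^sub>v w = 0\<^sub>v N \<longrightarrow> a = 0 \<and> b = 0)"

definition l2_norm_vec :: "real vec \<Rightarrow> real" where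
  "l2_norm_vec v = sqrt (scalar_prod v v)"

definition l1_norm_vec :: "real vec \<Rightarrow> real" where
  "l1_norm_vec v = (\<Sum>s<dim_vec v. \<bar>v $ s\<bar>)"

definition is_least_squares_solution :: "real mat \<Rightarrow> real vec \<Rightarrow> real vec \<Rightarrow> bool" where
  "is_least_squares_solution A b y \<longleftrightarrow>
     y \<in> carrier_vec (dim_col A) \<and>
     (\<forall>z\<in>carrier_vec (dim_col A). l2_norm_vec (A *\<^sub>v y - b) \<le> l2_norm_vec (A *\<^sub>v z - b))"

definition is_min_norm_solution :: "real mat \<Rightarrow> real vec \<Rightarrow> real vec \<Rightarrow> bool" where
  "is_min_norm_solution A b y \<longleftrightarrow>
     y \<in> carrier_vec (dim_col A) \<and> A *\<^sub>v y = b \<and>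
     (\<forall>z\<in>carrier_vec (dim_col A). A *\<^sub>v z = b \<longrightarrow> l2_norm_vec y \<le> l2_norm_vec z)"

(* Column s belongs to the stencil offset j = s - m, for s = 0, ..., 2m. *)
definition stencil_mat :: "nat \<Rightarrow> real \<Rightarrow> real mat" where
  "stencil_mat m dx =
     mat 2 (2 * m + 1) (\<lambda>(r, s). if r = 0 then 1 else (real s - real m) * dx)"

(* Both descriptions are definite when v and vx are linearly independent, m >= 1 and dx > 0. *)
definition first_order_fit :: "nat \<Rightarrow> real \<Rightarrow> real vec \<Rightarrow> real vec \<Rightarrow> real vec \<Rightarrow> real vec" where
  "first_order_fit N dt v vx vt =
     (THE y. is_least_squares_solution (mat_of_cols N [v, vx]) (v + dt \<cdot>\<^sub>v vt) y)"

definition first_order_coeffs ::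
    "nat \<Rightarrow> nat \<Rightarrow> real \<Rightarrow> real \<Rightarrow> real vec \<Rightarrow> real vec \<Rightarrow> real vec \<Rightarrow> real vec" where
  "first_order_coeffs m N dx dt v vx vt =
     (THE b. is_min_norm_solution (stencil_mat m dx) (first_order_fit N dt v vx vt) b)"

(* Grid points are numbered 1, ..., n, matrix rows and columns 0, ..., n - 1. The entry of
   \<beta> i for the offset j has index j + m. For n >= 2m + 1 the sum has at most one term. *)
definition inferred_operator :: "nat \<Rightarrow> nat \<Rightarrow> (nat \<Rightarrow> real vec) \<Rightarrow> real mat" where
  "inferred_operator m n \<beta> =
     mat n n (\<lambda>(r, s). \<Sum>j | j \<in> {- int m..int m} \<and> (int r + j) mod int n = int s.
                          \<beta> (Suc r) $ nat (j + int m))"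

definition discrete_time_stable :: "real mat \<Rightarrow> bool" where
  "discrete_time_stable A \<longleftrightarrow>
     (\<forall>z. eigenvalue (map_mat complex_of_real A) z \<longrightarrow> cmod z \<le> 1)"

end

theory Submission
  imports Defs
begin

text \<open>
  For a solution of the advection equation the right-hand side \<open>v + dt \<cdot>\<^sub>v vt\<close> of the least squares
  problem is the exact combination \<open>v + (c * dt) \<cdot>\<^sub>v vx\<close> of the two columns. The residual vanishes,
  and linear independence makes \<open>(1, c * dt)\<close> the only solution, whatever the data are.
  The second step therefore asks for the shortest stencil vector with sum \<open>1\<close> and first moment
  \<open>c * dt\<close>. Such a vector lies in the row space of the stencil matrix, so its entries are affine in
  the offset \<open>j\<close>; since the offsets sum to \<open>0\<close> and their squares to \<open>m (m + 1) (2 m + 1) / 3\<close>, the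
  entries are \<open>(1 + 3 r j / (m (m + 1))) / (2 m + 1)\<close> with Courant number \<open>r = c * dt / dx\<close>.

  The bound \<open>r \<le> (m + 1) / 3\<close> says exactly that the smallest of these entries, the one for \<open>j = - m\<close>,
  is nonnegative. The coefficients are then weights of a convex combination and their absolute
  values sum to \<open>1\<close>. Wrapping the stencil around the grid cannot increase absolute row sums, so the
  inferred operator is nonexpansive in the maximum norm and has no eigenvalue outside the closed
  unit disc.
\<close>

section \<open>Exact least squares and minimum norm solutions\<close>

lemma l2_norm_vec_le_iff:
  "l2_norm_vec v \<le> l2_norm_vec w \<longleftrightarrow> scalar_prod v v \<le> scalar_prod w w"
  by (simp add: l2_norm_vec_def)

lemma scalar_prod_self_nonneg: "0 \<le> scalar_prod v (v :: real vec)"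
  by (simp add: scalar_prod_def sum_nonneg)

lemma scalar_prod_self_le_0:
  fixes v :: "real vec"
  assumes "v \<in> carrier_vec n" "scalar_prod v v \<le> 0"
  shows "v = 0\<^sub>v n"
proof -
  have "(\<Sum>i\<in>{0..<n}. v $ i * v $ i) = 0"
    using assms scalar_prod_self_nonneg[of v] by (simp add: scalar_prod_def)
  then have "\<forall>i\<in>{0..<n}. v $ i * v $ i = 0"
    by (subst (asm) sum_nonneg_eq_0_iff) auto
  with assms(1) show ?thesis
    by (intro eq_vecI) auto
qed

lemma scalar_prod_self_add:
  fixes v w :: "real vec"
  assumes "v \<in> carrier_vec n" "w \<in> carrier_vec n"
  shows "scalar_prod (v + w) (v + w) = scalar_prod v v + 2 * scalar_prod v w + scalar_prod w w"
  using assms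
  by (simp add: scalar_prod_def algebra_simps sum.distrib sum_distrib_left)

text \<open>For a consistent system the least residual is \<open>0\<close>, and a residual of norm \<open>0\<close> is the
  zero vector.\<close>
lemma least_squares_solution_consistent:
  assumes A: "A \<in> carrier_mat r k" and y: "y \<in> carrier_vec k" and b: "A *\<^sub>v y = b"
  shows "is_least_squares_solution A b z \<longleftrightarrow> z \<in> carrier_vec k \<and> A *\<^sub>v z = b"
proof -
  have bc: "b \<in> carrier_vec r"
    using mult_mat_vec_carrier[OF A y] unfolding b .
  have res: "l2_norm_vec (b - b) = 0"
    using bc by (simp add: l2_norm_vec_def)
  have nonneg: "0 \<le> l2_norm_vec v" for v
    using scalar_prod_self_nonneg by (simp add: l2_norm_vec_def)
  have "A *\<^sub>v z = b" if "is_least_squares_solution A b z"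
  proof -
    have "l2_norm_vec (A *\<^sub>v z - b) \<le> l2_norm_vec (b - b)"
      using that A y b by (auto simp: is_least_squares_solution_def)
    then have "scalar_prod (A *\<^sub>v z - b) (A *\<^sub>v z - b) \<le> 0"
      using res by (simp add: l2_norm_vec_def)
    moreover have "A *\<^sub>v z - b \<in> carrier_vec r"
      using bc by (intro carrier_vecI) simp
    ultimately have d: "A *\<^sub>v z - b = 0\<^sub>v r"
      using scalar_prod_self_le_0 by blast
    show ?thesis
    proof (rule eq_vecI)
      show "dim_vec (A *\<^sub>v z) = dim_vec b"
        using A bc by simp
      fix i assume "i < dim_vec b"
      then show "(A *\<^sub>v z) $ i = b $ i"
        using arg_cong[OF d, of "\<lambda>v. v $ i"] bc by simp
    qed
  qed
  then show ?thesis
    using A res nonneg by (auto simp: is_least_squares_solution_def)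
qed

text \<open>Two solutions differ by a kernel vector, which is orthogonal to the row space; by Pythagoras
  a solution in the row space is strictly shorter than every other one. Exhibiting a multiplier
  \<open>w\<close> replaces the inversion of \<open>A * transpose_mat A\<close>.\<close>
lemma min_norm_solution_row_space:
  assumes A: "A \<in> carrier_mat r k" and w: "w \<in> carrier_vec r"
    and b: "A *\<^sub>v (transpose_mat A *\<^sub>v w) = b"
  shows "is_min_norm_solution A b z \<longleftrightarrow> z = transpose_mat A *\<^sub>v w"
proof -
  define p where "p = transpose_mat A *\<^sub>v w"
  have p: "p \<in> carrier_vec k"
    using A by (simp add: p_def carrier_vecI)
  have Ap: "A *\<^sub>v p = b"
    using b by (simp only: p_def)
  then have bc: "b \<in> carrier_vec r"
    using mult_mat_vec_carrier[OF A p] by (simp only:)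
  have pythagoras: "scalar_prod z z = scalar_prod p p + scalar_prod (z - p) (z - p)"
    if z: "z \<in> carrier_vec k" and "A *\<^sub>v z = b" for z
  proof -
    have d: "z - p \<in> carrier_vec k"
      using z p by simp
    have "A *\<^sub>v (z - p) = b - b"
      using mult_minus_distrib_mat_vec[OF A z p] that Ap by (simp only:)
    also have "\<dots> = 0\<^sub>v r"
      using bc by (rule minus_cancel_vec)
    finally have "A *\<^sub>v (z - p) = 0\<^sub>v r" .
    then have "scalar_prod p (z - p) = 0"
      using transpose_vec_mult_scalar[OF A d w] w by (simp add: p_def[symmetric])
    moreover have "p + (z - p) = z"
      using p z by (intro eq_vecI) auto
    ultimately show ?thesis
      using scalar_prod_self_add[OF p d] by simp
  qed
  show ?thesis
    unfolding p_def[symmetric]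
  proof
    assume "is_min_norm_solution A b z"
    then have z: "z \<in> carrier_vec k" "A *\<^sub>v z = b" and "l2_norm_vec z \<le> l2_norm_vec p"
      using A p Ap by (auto simp: is_min_norm_solution_def)
    then have "scalar_prod (z - p) (z - p) \<le> 0"
      using pythagoras[OF z] unfolding l2_norm_vec_le_iff by linarith
    then have d: "z - p = 0\<^sub>v k"
      using z p by (intro scalar_prod_self_le_0) auto
    show "z = p"
    proof (rule eq_vecI)
      show "dim_vec z = dim_vec p"
        using z p by simp
      fix i assume "i < dim_vec p"
      then show "z $ i = p $ i"
        using arg_cong[OF d, of "\<lambda>v. v $ i"] p by simp
    qed
  next
    have "l2_norm_vec p \<le> l2_norm_vec z'" if "z' \<in> carrier_vec k" "A *\<^sub>v z' = b" for z'
      using pythagoras[OF that] scalar_prod_self_nonneg[of "z' - p"]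
      unfolding l2_norm_vec_le_iff by linarith
    moreover assume "z = p"
    ultimately show "is_min_norm_solution A b z"
      using A p Ap by (auto simp: is_min_norm_solution_def)
  qed
qed

section \<open>The coefficients for advection data\<close>

lemma mat_of_two_cols_mult_vec:
  fixes v w :: "'a :: comm_semiring_1 vec"
  assumes "v \<in> carrier_vec N" "w \<in> carrier_vec N" "y \<in> carrier_vec 2"
  shows "mat_of_cols N [v, w] *\<^sub>v y = (y $ 0) \<cdot>\<^sub>v v + (y $ 1) \<cdot>\<^sub>v w"
  using assms
  by (intro eq_vecI) (auto simp: scalar_prod_def mat_of_cols_def numeral_2_eq_2 mult.commute)

lemma first_order_fit_advection:
  assumes v: "v \<in> carrier_vec N" and vx: "vx \<in> carrier_vec N"
    and indep: "lin_independent_pair N v vx" and vt: "vt = c \<cdot>\<^sub>v vx"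
  shows "first_order_fit N dt v vx vt = vec_of_list [1, c * dt]"
proof -
  let ?A = "mat_of_cols N [v, vx]" and ?y = "vec_of_list [1, c * dt]"
  have A: "?A \<in> carrier_mat N 2"
    by (simp add: numeral_2_eq_2 carrier_matI)
  have y: "?y \<in> carrier_vec 2"
    by (simp add: numeral_2_eq_2 carrier_vecI)
  have Ay: "?A *\<^sub>v ?y = v + dt \<cdot>\<^sub>v vt"
    using v vx y vt by (simp add: mat_of_two_cols_mult_vec smult_smult_assoc mult.commute)
  have unique: "z = ?y" if z: "z \<in> carrier_vec 2" and Az: "?A *\<^sub>v z = v + dt \<cdot>\<^sub>v vt" for z
  proof -
    have eq: "(z $ 0) \<cdot>\<^sub>v v + (z $ 1) \<cdot>\<^sub>v vx = v + (c * dt) \<cdot>\<^sub>v vx"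
      using Az mat_of_two_cols_mult_vec[OF v vx z] vt by (simp add: smult_smult_assoc mult.commute)
    have "(z $ 0 - 1) \<cdot>\<^sub>v v + (z $ 1 - c * dt) \<cdot>\<^sub>v vx = 0\<^sub>v N"
    proof (rule eq_vecI)
      fix i assume "i < dim_vec (0\<^sub>v N :: real vec)"
      then show "((z $ 0 - 1) \<cdot>\<^sub>v v + (z $ 1 - c * dt) \<cdot>\<^sub>v vx) $ i = 0\<^sub>v N $ i"
        using arg_cong[OF eq, of "\<lambda>v. v $ i"] v vx by (simp add: algebra_simps)
    qed (use v vx in simp)
    then have "z $ 0 - 1 = 0 \<and> z $ 1 - c * dt = 0"
      by (rule indep[unfolded lin_independent_pair_def, rule_format])
    then show ?thesis
      using z by (intro eq_vecI) (auto simp: numeral_2_eq_2 less_Suc_eq)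
  qed
  show ?thesis
    unfolding first_order_fit_def least_squares_solution_consistent[OF A y Ay]
  proof (rule the_equality)
    show "?y \<in> carrier_vec 2 \<and> ?A *\<^sub>v ?y = v + dt \<cdot>\<^sub>v vt"
      using y Ay ..
  qed (blast intro: unique)
qed

lemma sum_shifted: "(\<Sum>s<k. real s - a) = real k * (real k - 1) / 2 - real k * a"
  by (induction k) (auto simp: field_simps)

lemma sum_shifted_squares:
  "(\<Sum>s<k. (real s - a)\<^sup>2) =
     real k * (real k - 1) * (2 * real k - 1) / 6 - a * real k * (real k - 1) + real k * a\<^sup>2"
  by (induction k) (auto simp: field_simps power2_eq_square)

lemma sum_stencil_offsets: "(\<Sum>s<2 * m + 1. real s - real m) = 0"
  by (subst sum_shifted) (simp add: field_simps)

lemma sum_stencil_offsets_squares: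
  "(\<Sum>s<2 * m + 1. (real s - real m)\<^sup>2) = real m * (real m + 1) * (2 * real m + 1) / 3"
  by (subst sum_shifted_squares) (simp add: field_simps power2_eq_square)

lemma first_order_coeffs_advection:
  assumes m: "m \<ge> 1" and dx: "dx > 0"
    and fit: "first_order_fit N dt v vx vt = vec_of_list [1, c * dt]"
  shows "first_order_coeffs m N dx dt v vx vt =
     vec (2 * m + 1) (\<lambda>s. (1 + 3 * (c * dt / dx) * (real s - real m) / (real m * (real m + 1)))
                            / (2 * real m + 1))"
    (is "_ = vec _ ?b")
proof -
  define M where "M = stencil_mat m dx"
  define S where "S = real m * (real m + 1) * (2 * real m + 1) / 3"
  \<comment> \<open>The Gram matrix of the two rows of the stencil matrix is diagonal with entries
     \<open>2 * m + 1\<close> and \<open>dx\<^sup>2 * S\<close>, so the multiplier needs no matrix inversion.\<close>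
  define w where "w = vec_of_list [1 / (2 * real m + 1), c * dt / (dx\<^sup>2 * S)]"
  have M: "M \<in> carrier_mat 2 (2 * m + 1)"
    by (simp add: M_def stencil_mat_def)
  have w: "w \<in> carrier_vec 2"
    by (simp add: w_def numeral_2_eq_2 carrier_vecI)
  have S: "S > 0"
    using m by (simp add: S_def)
  have Mw: "transpose_mat M *\<^sub>v w = vec (2 * m + 1) ?b"
  proof (rule eq_vecI)
    fix s assume "s < dim_vec (vec (2 * m + 1) ?b)"
    then have s: "s < 2 * m + 1"
      by simp
    then have "(transpose_mat M *\<^sub>v w) $ s =
        1 / (2 * real m + 1) + (real s - real m) * dx * (c * dt / (dx\<^sup>2 * S))"
      using w by (simp add: M_def stencil_mat_def w_def scalar_prod_def numeral_2_eq_2)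
    also have "\<dots> = ?b s"
    proof -
      have "real m > 0" "2 * real m + 1 > 0" "real m + 1 > 0"
        using m by auto
      then show ?thesis
        using dx by (simp add: S_def divide_simps power2_eq_square)
    qed
    finally show "(transpose_mat M *\<^sub>v w) $ s = vec (2 * m + 1) ?b $ s"
      using s by simp
  qed (use M in simp)
  have b: "?b s = 1 / (2 * real m + 1) + (c * dt / dx / S) * (real s - real m)" for s
    using m by (simp add: S_def divide_simps)
  have "(\<Sum>s<2 * m + 1. ?b s) = 1"
    unfolding b sum.distrib sum_distrib_left[symmetric] sum_stencil_offsets by simp
  moreover have "(\<Sum>s<2 * m + 1. (real s - real m) * dx * ?b s) = c * dt"
  proof -
    have "(\<Sum>s<2 * m + 1. (real s - real m) * dx * ?b s) =
        (\<Sum>s<2 * m + 1. dx / (2 * real m + 1) * (real s - real m) + (c * dt / S) * (real s - real m)\<^sup>2)"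
    proof (intro sum.cong refl)
      fix s
      have "j * dx * (1 / K + c * dt / dx / S * j) = dx / K * j + c * dt / S * j\<^sup>2" for j K
        using dx by (simp add: distrib_left power2_eq_square ac_simps)
      then show "(real s - real m) * dx * ?b s =
          dx / (2 * real m + 1) * (real s - real m) + (c * dt / S) * (real s - real m)\<^sup>2"
        unfolding b .
    qed
    also have "\<dots> = (c * dt / S) * S"
      unfolding sum.distrib sum_distrib_left[symmetric] sum_stencil_offsets sum_stencil_offsets_squares
      by (simp add: S_def)
    finally show ?thesis
      using S by simp
  qed
  ultimately have "M *\<^sub>v vec (2 * m + 1) ?b = vec_of_list [1, c * dt]"
    by (intro eq_vecI)
       (auto simp: M_def stencil_mat_def scalar_prod_def less_Suc_eq numeral_2_eq_2 atLeast0LessThan)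
  then have "M *\<^sub>v (transpose_mat M *\<^sub>v w) = vec_of_list [1, c * dt]"
    by (simp only: Mw)
  from min_norm_solution_row_space[OF M w this]
  have "is_min_norm_solution M (vec_of_list [1, c * dt]) z \<longleftrightarrow> z = vec (2 * m + 1) ?b" for z
    by (simp only: Mw)
  then show ?thesis
    unfolding first_order_coeffs_def fit M_def[symmetric] by (intro the_equality) (simp_all only:)
qed

text \<open>Nonnegativity of all entries turns the norm into the plain sum, in which the term linear in
  the offset cancels by symmetry of the stencil. The bound on \<open>r\<close> is what the entry \<open>s = 0\<close>
  requires.\<close>
lemma l1_norm_first_order_coeffs:
  assumes m: "m \<ge> 1" and r: "0 \<le> r" "r \<le> (real m + 1) / 3"
  shows "l1_norm_vec (vec (2 * m + 1)
     (\<lambda>s. (1 + 3 * r * (real s - real m) / (real m * (real m + 1))) / (2 * real m + 1))) = 1"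
    (is "l1_norm_vec (vec _ ?b) = 1")
proof -
  have nonneg: "0 \<le> ?b s" for s
  proof -
    have "3 * r * (real m - real s) \<le> 3 * r * real m"
      using r by (intro mult_left_mono) auto
    also have "\<dots> \<le> (real m + 1) * real m"
      using r by (intro mult_right_mono) auto
    finally have "- (real m * (real m + 1)) \<le> 3 * r * (real s - real m)"
      by (simp add: algebra_simps)
    then have "- 1 \<le> 3 * r * (real s - real m) / (real m * (real m + 1))"
      using m by (simp add: le_divide_eq)
    then have "0 \<le> 1 + 3 * r * (real s - real m) / (real m * (real m + 1))"
      by linarith
    then show ?thesis
      by (intro divide_nonneg_nonneg) auto
  qed
  have b: "?b s = 1 / (2 * real m + 1)
      + (3 * r / (real m * (real m + 1)) / (2 * real m + 1)) * (real s - real m)" for s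
    by (simp add: add_divide_distrib)
  have "l1_norm_vec (vec (2 * m + 1) ?b) = (\<Sum>s<2 * m + 1. ?b s)"
    unfolding l1_norm_vec_def by (intro sum.cong) (simp_all only: dim_vec index_vec lessThan_iff abs_of_nonneg[OF nonneg])
  also have "\<dots> = 1"
    unfolding b sum.distrib sum_distrib_left[symmetric] sum_stencil_offsets by simp
  finally show ?thesis .
qed

section \<open>Row sums and stability\<close>

text \<open>Compare both sides of the eigenvector equation at a component \<open>r\<close> of largest modulus.\<close>
lemma eigenvalue_le_max_row_sum:
  fixes A :: "complex mat"
  assumes A: "A \<in> carrier_mat n n" and ev: "eigenvalue A z"
    and rows: "\<And>r. r < n \<Longrightarrow> (\<Sum>s<n. cmod (A $$ (r, s))) \<le> C"
  shows "cmod z \<le> C"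
proof -
  obtain v where v: "v \<in> carrier_vec n" "v \<noteq> 0\<^sub>v n" and Av: "A *\<^sub>v v = z \<cdot>\<^sub>v v"
    using ev A by (auto simp: eigenvalue_def eigenvector_def)
  obtain i where i: "i < n" "v $ i \<noteq> 0"
    using v by (metis carrier_vecD eq_vecI index_zero_vec)
  have "Max ((\<lambda>s. cmod (v $ s)) ` {..<n}) \<in> (\<lambda>s. cmod (v $ s)) ` {..<n}"
    using i by (intro Max_in) auto
  then obtain r where r: "r < n" and "Max ((\<lambda>s. cmod (v $ s)) ` {..<n}) = cmod (v $ r)"
    by auto
  then have max: "cmod (v $ s) \<le> cmod (v $ r)" if "s < n" for s
    using that by (metis Max_ge finite_imageI finite_lessThan imageI lessThan_iff)
  have "cmod z * cmod (v $ r) = cmod ((A *\<^sub>v v) $ r)"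
    using r v by (simp add: Av norm_mult)
  also have "\<dots> = cmod (\<Sum>s<n. A $$ (r, s) * v $ s)"
    using A v r by (simp add: scalar_prod_def atLeast0LessThan)
  also have "\<dots> \<le> (\<Sum>s<n. cmod (A $$ (r, s)) * cmod (v $ r))"
    using max by (intro sum_norm_le) (auto simp: norm_mult intro: mult_left_mono)
  also have "\<dots> \<le> C * cmod (v $ r)"
    unfolding sum_distrib_right[symmetric] using rows[OF r] by (intro mult_right_mono) auto
  finally show ?thesis
    using max[OF i(1)] i(2) by (smt (verit) mult_le_cancel_right_pos zero_less_norm_iff)
qed

text \<open>Each offset contributes to exactly one column, so the triangle inequality bounds the row sum
  even when several offsets wrap around to the same column.\<close>
lemma inferred_operator_row_sum:
  assumes r: "r < n" and dim: "dim_vec (\<beta> (Suc r)) = 2 * m + 1"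
  shows "(\<Sum>s<n. \<bar>inferred_operator m n \<beta> $$ (r, s)\<bar>) \<le> l1_norm_vec (\<beta> (Suc r))"
proof -
  let ?J = "{- int m..int m}" and ?b = "\<lambda>j. \<bar>\<beta> (Suc r) $ nat (j + int m)\<bar>"
  have n: "int n > 0"
    using r by simp
  have "(\<Sum>s<n. \<bar>inferred_operator m n \<beta> $$ (r, s)\<bar>)
      \<le> (\<Sum>s<n. \<Sum>j | j \<in> ?J \<and> nat ((int r + j) mod int n) = s. ?b j)"
  proof (rule sum_mono)
    fix s assume s: "s \<in> {..<n}"
    have "\<bar>inferred_operator m n \<beta> $$ (r, s)\<bar>
        \<le> (\<Sum>j | j \<in> ?J \<and> (int r + j) mod int n = int s. ?b j)"
      using r s by (simp add: inferred_operator_def)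
    also have "\<dots> = (\<Sum>j | j \<in> ?J \<and> nat ((int r + j) mod int n) = s. ?b j)"
      using n by (intro sum.cong) (auto simp: nat_eq_iff)
    finally show "\<bar>inferred_operator m n \<beta> $$ (r, s)\<bar> \<le> \<dots>" .
  qed
  also have "\<dots> = (\<Sum>j\<in>?J. ?b j)"
    using n by (intro sum.group) (auto simp: nat_less_iff)
  also have "\<dots> = (\<Sum>s<2 * m + 1. \<bar>\<beta> (Suc r) $ s\<bar>)"
    by (rule sum.reindex_bij_witness[where i = "\<lambda>s. int s - int m" and j = "\<lambda>j. nat (j + int m)"])
       auto
  finally show ?thesis
    by (simp add: l1_norm_vec_def dim)
qed

lemma inferred_operator_stable:
  assumes dim: "\<And>i. i \<in> {1..n} \<Longrightarrow> dim_vec (\<beta> i) = 2 * m + 1"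
    and norm: "\<And>i. i \<in> {1..n} \<Longrightarrow> l1_norm_vec (\<beta> i) \<le> 1"
  shows "discrete_time_stable (inferred_operator m n \<beta>)"
  unfolding discrete_time_stable_def
proof (intro allI impI)
  let ?A = "inferred_operator m n \<beta>"
  fix z assume "eigenvalue (map_mat complex_of_real ?A) z"
  moreover have A: "?A \<in> carrier_mat n n"
    by (simp add: inferred_operator_def)
  moreover have "(\<Sum>s<n. cmod (map_mat complex_of_real ?A $$ (r, s))) \<le> 1" if "r < n" for r
  proof -
    have "(\<Sum>s<n. cmod (map_mat complex_of_real ?A $$ (r, s))) = (\<Sum>s<n. \<bar>?A $$ (r, s)\<bar>)"
      using A that by (intro sum.cong) auto
    also have "\<dots> \<le> l1_norm_vec (\<beta> (Suc r))"
      using that dim by (intro inferred_operator_row_sum) auto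
    also have "\<dots> \<le> 1"
      using that norm by auto
    finally show ?thesis .
  qed
  ultimately show "cmod z \<le> 1"
    by (intro eigenvalue_le_max_row_sum) auto
qed

theorem mainTheorem2:
  fixes m n N :: nat
    and c dx dt :: real
    and X T :: "real set"
    and u :: "real \<Rightarrow> real \<Rightarrow> real"
    and x t :: "nat \<Rightarrow> real"
    and \<beta> :: "nat \<Rightarrow> real vec"
  assumes "m \<ge> 1" and "n \<ge> 2 * m + 1" and "N \<ge> 2"
    and "c > 0" and "dx > 0" and "dt > 0"
    and "is_interval X" and "is_interval T"
    and "smooth_advection_solution c X T u"
    and "\<And>i. i \<in> {1..n} \<Longrightarrow> x i \<in> X"
    and "\<And>k. k < N \<Longrightarrow> t k \<in> T"
    and "\<And>i. i \<in> {1..<n} \<Longrightarrow> x (Suc i) - x i = dx"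
    and "\<And>k. Suc k < N \<Longrightarrow> t (Suc k) - t k = dt"
    and "\<And>i. i \<in> {1..n} \<Longrightarrow>
           lin_independent_pair N (time_samples N t u (x i)) (time_samples N t (partial_x X u) (x i))"
    and "\<And>i. i \<in> {1..n} \<Longrightarrow>
           \<beta> i = first_order_coeffs m N dx dt (time_samples N t u (x i))
                   (time_samples N t (partial_x X u) (x i)) (time_samples N t (partial_t T u) (x i))"
    and "dt / dx \<le> (real m + 1) / (3 * c)"
  shows "(\<forall>i\<in>{1..n}. l1_norm_vec (\<beta> i) \<le> 1) \<and>
         discrete_time_stable (inferred_operator m n \<beta>)"
proof -
  have \<beta>: "\<beta> i = vec (2 * m + 1)
      (\<lambda>s. (1 + 3 * (c * dt / dx) * (real s - real m) / (real m * (real m + 1)))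
             / (2 * real m + 1))"
    if i: "i \<in> {1..n}" for i
  proof -
    have "partial_t T u (x i) (t k) = c * partial_x X u (x i) (t k)" if "k < N" for k
      using assms(9) assms(10)[OF i] assms(11)[OF that] by (auto simp: smooth_advection_solution_def)
    then have vt: "time_samples N t (partial_t T u) (x i) =
        c \<cdot>\<^sub>v time_samples N t (partial_x X u) (x i)"
      by (intro eq_vecI) (auto simp: time_samples_def)
    have "first_order_fit N dt (time_samples N t u (x i)) (time_samples N t (partial_x X u) (x i))
        (time_samples N t (partial_t T u) (x i)) = vec_of_list [1, c * dt]"
      using assms(14)[OF i] vt by (intro first_order_fit_advection) (auto simp: time_samples_def)
    with assms(1,5) show ?thesis
      unfolding assms(15)[OF i] by (intro first_order_coeffs_advection)
  qed
  have "0 \<le> c * dt / dx" "c * dt / dx \<le> (real m + 1) / 3"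
    using assms(4-6,16) by (auto simp: field_simps)
  with assms(1) have "l1_norm_vec (\<beta> i) = 1" if "i \<in> {1..n}" for i
    unfolding \<beta>[OF that] by (intro l1_norm_first_order_coeffs)
  then show ?thesis
    using \<beta> by (auto intro!: inferred_operator_stable)
qed

end
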